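(* Fix an expert $i$ and an attribute $j$. Let $r_e$, $e\in[E]$, represent the rankings corresponding to the partial preference context $\mathcal P_{ij}$, and let $v(x)$ denote the target utility density function. By Arrow–Pratt's definition of risk preference, the optimal solution $u^*_{ij}(x)$ of the minimum cross-entropy utility problem with partial preference context $$\min_{u_{ij}\in\mathcal P_{ij}}\int_0^{K_{ij}}u_{ij}(x)\ln\Big(\frac{u_{ij}(x)}{v(x)}\Big)\,dx$$ has the identical risk preference $\eta_{ij}(x)$ with the target utility density function in each interval of $$(0,r_1]\cup\Big(\bigcup_{e\in[E]\setminus\{1\}}(r_{e-1},r_e]\Big)\cup(r_E,K_{ij}].$$ Specifically, the risk preference within each interval is given by $$\eta_{ij}(x)=-\frac{d}{dx}\ln\big(u^*_{ij}(x)\big)=-\frac{d}{dx}\ln\big(v(x)\big).$$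
   Context: $[n]=\{1,\dots,n\}$. $K_{ij}$ is the largest rank that expert $i$ assigns to alternatives under attribute $j$. The target utility density $v$ is the derivative of a target utility function $V$, which is continuous and twice-differentiable. The partial preference context $\mathcal P_{ij}$ is the set of utility density functions $u_{ij}$ on $[0,K_{ij}]$ with $u_{ij}(x)\ge0$ and $\int_0^{K_{ij}}u_{ij}(x)\,dx=1$ that satisfy finitely many given constraints, each of one of the following forms for a given rank $r$ and given constant $\alpha$, $\beta$ or $\gamma$: ratio scale: $\int_0^ru_{ij}(x)\,dx-\alpha\int_0^{r-1}u_{ij}(x)\,dx=0$; absolute difference: $\int_0^ru_{ij}(x)\,dx-\int_0^{r-1}u_{ij}(x)\,dx=\beta$; lower bound (imposed as an equality): $\int_0^ru_{ij}(x)\,dx=\gamma$. The rankings corresponding to these constraints are denoted $r_e$, $e\in[E]$; they are the breakpoints of the piecewise function $u^*_{ij}$. The Arrow–Pratt risk preference function associated with a utility density $u$ is $\eta(x)=-\frac{d}{dx}\ln u(x)$.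
   Formalization: Intervals where the constraints force every feasible density to vanish a.e. are excluded, since ln u* is undefined there; the pointwise claim is for an a.e.-equal optimal representative of u*, or u* itself where continuous; v>0 is assumed, and r−1 counts as a ranking. *)

theory Defs
  imports "HOL-Analysis.Analysis"
begin

datatype preference_constraint =
    Ratio_Scale nat real
  | Absolute_Difference nat real
  | Lower_Bound nat real

fun constraint_rank :: "preference_constraint \<Rightarrow> nat" where
  "constraint_rank (Ratio_Scale r \<alpha>) = r"
| "constraint_rank (Absolute_Difference r \<beta>) = r"
| "constraint_rank (Lower_Bound r \<gamma>) = r"

fun satisfies :: "(real \<Rightarrow> real) \<Rightarrow> preference_constraint \<Rightarrow> bool" where
  "satisfies u (Ratio_Scale r \<alpha>) \<longleftrightarrow>
     (LBINT x:{0..real r}. u x) - \<alpha> * (LBINT x:{0..real (r - 1)}. u x) = 0"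
| "satisfies u (Absolute_Difference r \<beta>) \<longleftrightarrow>
     (LBINT x:{0..real r}. u x) - (LBINT x:{0..real (r - 1)}. u x) = \<beta>"
| "satisfies u (Lower_Bound r \<gamma>) \<longleftrightarrow>
     (LBINT x:{0..real r}. u x) = \<gamma>"

text \<open>The rankings entering a constraint are all upper integration limits occurring in it: the
  first two kinds involve both \<open>r\<close> and \<open>r - 1\<close>, and the optimal density may jump at either.\<close>

fun constraint_rankings :: "preference_constraint \<Rightarrow> nat set" where
  "constraint_rankings (Ratio_Scale r \<alpha>) = {r - 1, r}"
| "constraint_rankings (Absolute_Difference r \<beta>) = {r - 1, r}"
| "constraint_rankings (Lower_Bound r \<gamma>) = {r}"

definition utility_densities :: "nat \<Rightarrow> (real \<Rightarrow> real) set" where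
  "utility_densities K =
     {u. set_integrable lborel {0..real K} u \<and> (\<forall>x\<in>{0..real K}. 0 \<le> u x) \<and>
         (LBINT x:{0..real K}. u x) = 1}"

definition preference_context :: "nat \<Rightarrow> preference_constraint set \<Rightarrow> (real \<Rightarrow> real) set" where
  "preference_context K C = {u \<in> utility_densities K. \<forall>c\<in>C. satisfies u c}"

text \<open>For \<open>v\<close> positive almost everywhere and integrable, \<open>u ln (u / v) \<ge> u - v\<close> bounds the integrand
  below by an integrable function, so the integral exists in \<open>(-\<infinity>, \<infinity>]\<close> and non-integrability
  means \<open>\<infinity>\<close>. The bare Bochner integral would be 0 in that case. The convention
  \<open>0 ln 0 = 0\<close> is inherited from \<open>ln 0 = 0\<close>.\<close>

definition cross_entropy :: "nat \<Rightarrow> (real \<Rightarrow> real) \<Rightarrow> (real \<Rightarrow> real) \<Rightarrow> ereal" where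
  "cross_entropy K v u =
     (if set_integrable lborel {0..real K} (\<lambda>x. u x * ln (u x / v x))
      then ereal (LBINT x:{0..real K}. u x * ln (u x / v x)) else \<infinity>)"

definition optimal_density ::
  "nat \<Rightarrow> preference_constraint set \<Rightarrow> (real \<Rightarrow> real) \<Rightarrow> (real \<Rightarrow> real) \<Rightarrow> bool" where
  "optimal_density K C v u \<longleftrightarrow>
     u \<in> preference_context K C \<and>
     (\<forall>w\<in>preference_context K C. cross_entropy K v u \<le> cross_entropy K v w)"

definition preference_intervals :: "nat \<Rightarrow> nat \<Rightarrow> (nat \<Rightarrow> nat) \<Rightarrow> real set set" where
  "preference_intervals K E r =
     {{0<..real (r 1)}} \<union>
     (\<lambda>e. {real (r (e - 1))<..real (r e)}) ` ({1..E} - {1}) \<union>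
     {{real (r E)<..real K}}"

text \<open>The constraints may force every feasible density to vanish almost everywhere on an interval
  (for instance through \<open>\<beta> = 0\<close>), in which case \<open>ln u\<close> makes no sense there. The following
  excludes exactly these intervals.\<close>

definition nondegenerate :: "nat \<Rightarrow> preference_constraint set \<Rightarrow> real set \<Rightarrow> bool" where
  "nondegenerate K C I \<longleftrightarrow> (\<exists>u\<in>preference_context K C. 0 < (LBINT x:I. u x))"

text \<open>The derivative is taken within \<open>S\<close>, hence one-sided at an endpoint of \<open>S\<close>. Positivity makes
  \<open>ln u\<close> meaningful, as \<open>ln\<close> is total.\<close>

definition has_risk_preference ::
  "(real \<Rightarrow> real) \<Rightarrow> (real \<Rightarrow> real) \<Rightarrow> real set \<Rightarrow> real \<Rightarrow> bool" where
  "has_risk_preference u \<eta> S x \<longleftrightarrow>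
     (\<forall>t\<in>S. 0 < u t) \<and> ((\<lambda>t. ln (u t)) has_real_derivative - \<eta> x) (at x within S)"

definition same_risk_preference ::
  "nat \<Rightarrow> (real \<Rightarrow> real) \<Rightarrow> (real \<Rightarrow> real) \<Rightarrow> real set \<Rightarrow> bool" where
  "same_risk_preference K v u I \<longleftrightarrow>
     (\<exists>\<eta>. \<forall>x\<in>I. has_risk_preference u \<eta> I x \<and> has_risk_preference v \<eta> {0<..real K} x)"

end

theory Submission
  imports Defs
begin

text \<open>The constraints see a density \<open>u\<close> only through its integrals over the preference intervals.
  Let \<open>g\<close> be the multiple of \<open>v\<close> on each interval that has the same integrals as \<open>u\<close>. Then \<open>g\<close> is
  feasible together with \<open>u\<close>, and by Gibbs' inequality its cross entropy is at most that of \<open>u\<close>, with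
  equality only if \<open>u = g\<close> almost everywhere. So an optimal density is almost everywhere a constant
  \<open>c\<close> times \<open>v\<close> on each interval, and \<open>ln (c v)\<close> has the derivative of \<open>ln v\<close>. It remains to see
  \<open>c > 0\<close> on a nondegenerate interval: otherwise mixing in a little of a feasible density with
  positive mass there lowers the objective, as \<open>x ln x\<close> has slope \<open>-\<infinity>\<close> at \<open>0\<close>.\<close>

section \<open>The function \<open>x ln x\<close>\<close>

text \<open>This is \<open>ln y \<le> y - 1\<close> at \<open>y = g / u\<close>, multiplied by
  \<open>u\<close>; for \<open>u = 0\<close> the left side is negative and the right side is
  0.\<close>

lemma mult_ln_div_ge:
  fixes u g :: real
  assumes "0 \<le> u" "0 < g"
  shows "u - g \<le> u * ln (u / g)"
proof (cases "u = 0")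
  case False
  with assms have "u * ln (g / u) \<le> u * (g / u - 1)"
    by (intro mult_left_mono ln_le_minus_one) auto
  with False assms show ?thesis by (simp add: ln_div algebra_simps)
qed (use assms in auto)

lemma mult_ln_div_eq_imp:
  fixes u g :: real
  assumes "0 \<le> u" "0 < g" "u * ln (u / g) = u - g"
  shows "u = g"
proof (cases "u = 0")
  case False
  with assms have "ln (g / u) = g / u - 1"
    by (simp add: ln_div field_simps)
  with False assms ln_eq_minus_one[of "g / u"] show ?thesis by simp
qed (use assms in auto)

text \<open>The points \<open>a\<close> and \<open>b\<close> may be 0, where \<open>x ln x\<close>
  has no derivative, so the proof uses only the tangent at the positive point
  \<open>y\<close>.\<close>

lemma mult_ln_convex:
  fixes a b t :: real
  assumes "0 \<le> a" "0 \<le> b" "0 < t" "t < 1"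
  defines "y \<equiv> (1 - t) * a + t * b"
  shows "y * ln y \<le> (1 - t) * (a * ln a) + t * (b * ln b)"
proof (cases "a = 0 \<and> b = 0")
  case False
  with assms have y: "0 < y"
    by (metis add_nonneg_pos add_pos_nonneg diff_gt_0_iff_gt less_eq_real_def mult_nonneg_nonneg
        mult_pos_pos)
  \<comment> \<open>The tangent at \<open>y\<close> is \<open>c * ln y + (c - y)\<close>; the terms
    \<open>c - y\<close> average to 0 over \<open>a\<close> and \<open>b\<close>.\<close>
  have tangent: "c - y \<le> c * ln c - c * ln y" if "0 \<le> c" for c
    using mult_ln_div_ge[OF that y] y that by (cases "c = 0") (auto simp: ln_div algebra_simps)
  have "0 = (1 - t) * (a - y) + t * (b - y)" by (simp add: y_def algebra_simps)
  also have "\<dots> \<le> (1 - t) * (a * ln a - a * ln y) + t * (b * ln b - b * ln y)"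
    using tangent assms by (intro add_mono mult_left_mono) auto
  also have "\<dots> = (1 - t) * (a * ln a) + t * (b * ln b) - y * ln y"
    by (simp add: y_def algebra_simps)
  finally show ?thesis by simp
qed (use assms in auto)

text \<open>In coordinate \<open>j\<close> the mixture is \<open>t * b j\<close>, and its logarithm
  splits off the term \<open>t * s * ln t\<close>; convexity bounds the other coordinates by the
  chord. The total is at most \<open>A + t * (B - A + s * ln t)\<close>, which is below
  \<open>A\<close> once \<open>s * ln t < A - B\<close>.\<close>

lemma mult_ln_sum_decreases_off_zero:
  fixes m a b :: "'i \<Rightarrow> real"
  assumes "finite P" "j \<in> P" "\<forall>i\<in>P. 0 \<le> m i" "\<forall>i\<in>P. 0 \<le> a i" "\<forall>i\<in>P. 0 \<le> b i"
    and "0 < m j" "a j = 0" "0 < b j"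
  shows "\<exists>t. 0 < t \<and> t < 1 \<and>
    (\<Sum>i\<in>P. m i * (((1 - t) * a i + t * b i) * ln ((1 - t) * a i + t * b i)))
      < (\<Sum>i\<in>P. m i * (a i * ln (a i)))"
proof -
  define A where "A = (\<Sum>i\<in>P. m i * (a i * ln (a i)))"
  define B where "B = (\<Sum>i\<in>P. m i * (b i * ln (b i)))"
  define s where "s = m j * b j"
  \<comment> \<open>Chosen so that \<open>s * ln t\<close> is exactly
    \<open>- (\<bar>B - A\<bar> + 1)\<close>, which outweighs \<open>B - A\<close> whatever its
    sign; as the exponent is negative, \<open>t < 1\<close>.\<close>
  define t where "t = exp (- (\<bar>B - A\<bar> + 1) / s)"
  have s: "0 < s" using assms by (simp add: s_def)
  have t: "0 < t" "t < 1" using s by (auto simp: t_def divide_simps)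
  have lnt: "s * ln t = - (\<bar>B - A\<bar> + 1)" using s by (simp add: t_def)
  have "(\<Sum>i\<in>P. m i * (((1 - t) * a i + t * b i) * ln ((1 - t) * a i + t * b i)))
      \<le> (\<Sum>i\<in>P. (1 - t) * (m i * (a i * ln (a i))) + t * (m i * (b i * ln (b i)))
            + (if i = j then t * (s * ln t) else 0))"
  proof (rule sum_mono)
    fix i assume i: "i \<in> P"
    show "m i * (((1 - t) * a i + t * b i) * ln ((1 - t) * a i + t * b i))
      \<le> (1 - t) * (m i * (a i * ln (a i))) + t * (m i * (b i * ln (b i)))
            + (if i = j then t * (s * ln t) else 0)"
    proof (cases "i = j")
      case True
      with assms t show ?thesis by (simp add: s_def ln_mult_pos algebra_simps)
    next
      case False
      have "m i * (((1 - t) * a i + t * b i) * ln ((1 - t) * a i + t * b i))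
        \<le> m i * ((1 - t) * (a i * ln (a i)) + t * (b i * ln (b i)))"
        using assms i t by (intro mult_left_mono mult_ln_convex) auto
      with False show ?thesis by (simp add: algebra_simps)
    qed
  qed
  also have "\<dots> = (1 - t) * A + t * B + t * (s * ln t)"
    using assms by (simp add: sum.distrib A_def B_def sum_distrib_left)
  also have "\<dots> = A + t * (B - A - (\<bar>B - A\<bar> + 1))"
    unfolding lnt by (simp add: algebra_simps)
  also have "\<dots> < A" using t by (simp add: mult_less_0_iff)
  finally show ?thesis using t unfolding A_def by blast
qed

section \<open>Reweighting on a finite partition\<close>

locale cell_partition =
  fixes M :: "'a measure" and P :: "'a set set" and v :: "'a \<Rightarrow> real"
  assumes finite_cells: "finite P"
    and disjoint_cells: "disjoint P"
    and Union_cells: "\<Union>P = space M"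
    and sets_cells: "P \<subseteq> sets M"
    and integrable_v: "integrable M v"
    and v_pos: "\<And>x. x \<in> space M \<Longrightarrow> 0 < v x"
begin

definition step :: "('a set \<Rightarrow> real) \<Rightarrow> 'a \<Rightarrow> real" where
  "step \<phi> x = (\<Sum>I\<in>P. \<phi> I * indicator I x)"

text \<open>This is the conditional expectation of \<open>u / v\<close> on the cell under the
  measure with density \<open>v\<close>. On a null cell, for example an empty one, it is
  \<open>0 / 0 = 0\<close>.\<close>

definition coeff :: "('a \<Rightarrow> real) \<Rightarrow> 'a set \<Rightarrow> real" where
  "coeff u I = (LINT x:I|M. u x) / (LINT x:I|M. v x)"

definition reweight :: "('a \<Rightarrow> real) \<Rightarrow> 'a \<Rightarrow> real" where
  "reweight u x = step (coeff u) x * v x"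

lemma step_eq:
  assumes "I \<in> P" "x \<in> I"
  shows "step \<phi> x = \<phi> I"
proof -
  have "step \<phi> x = (\<Sum>J\<in>P. if J = I then \<phi> J else 0)"
    unfolding step_def using assms disjoint_cells
    by (intro sum.cong) (auto simp: disjoint_def split: split_indicator)
  with assms finite_cells show ?thesis by simp
qed

lemma cell_exists:
  assumes "x \<in> space M"
  obtains I where "I \<in> P" "x \<in> I"
  using assms Union_cells by blast

lemma cells_subset: "I \<in> P \<Longrightarrow> I \<subseteq> space M"
  using Union_cells by blast

lemma integrable_cell:
  assumes "integrable M (u :: 'a \<Rightarrow> real)" "I \<in> P"
  shows "set_integrable M I u"
  using assms sets_cells unfolding set_integrable_def by (intro integrable_mult_indicator) auto

lemma has_integral_step_mult:
  assumes "integrable M u"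
  shows "has_bochner_integral M (\<lambda>x. step \<phi> x * u x) (\<Sum>I\<in>P. \<phi> I * (LINT x:I|M. u x))"
proof -
  have "has_bochner_integral M (\<lambda>x. \<Sum>I\<in>P. \<phi> I * (indicator I x *\<^sub>R u x))
      (\<Sum>I\<in>P. \<phi> I * (LINT x:I|M. u x))"
    using integrable_cell[OF assms]
    unfolding set_integrable_def set_lebesgue_integral_def
    by (intro has_bochner_integral_sum has_bochner_integral_mult_right has_bochner_integral_integrable) auto
  then show ?thesis by (simp add: step_def sum_distrib_right mult.assoc)
qed

lemma integrable_step_mult: "integrable M u \<Longrightarrow> integrable M (\<lambda>x. step \<phi> x * u x)"
  and integral_step_mult:
    "integrable M u \<Longrightarrow> (LINT x|M. step \<phi> x * u x) = (\<Sum>I\<in>P. \<phi> I * (LINT x:I|M. u x))"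
  using has_integral_step_mult[of u \<phi>] by (auto simp: has_bochner_integral_iff)

lemma integral_cells:
  fixes u :: "'a \<Rightarrow> real"
  assumes "integrable M u" "Q \<subseteq> P"
  shows "(LINT x:\<Union>Q|M. u x) = (\<Sum>I\<in>Q. LINT x:I|M. u x)"
proof -
  have "(LINT x:\<Union>Q|M. u x) = (LINT x|M. step (\<lambda>I. of_bool (I \<in> Q)) x * u x)"
    unfolding set_lebesgue_integral_def
  proof (rule Bochner_Integration.integral_cong)
    fix x assume "x \<in> space M"
    then obtain I where I: "I \<in> P" "x \<in> I" by (rule cell_exists)
    have "x \<in> \<Union>Q \<longleftrightarrow> I \<in> Q"
      using I disjointD[OF disjoint_cells I(1)] \<open>Q \<subseteq> P\<close> by blast
    with I show "indicator (\<Union>Q) x *\<^sub>R u x = step (\<lambda>I. of_bool (I \<in> Q)) x * u x"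
      by (simp add: step_eq indicator_def)
  qed simp
  also have "\<dots> = (\<Sum>I\<in>Q. LINT x:I|M. u x)"
    using assms finite_cells
    by (simp add: integral_step_mult of_bool_def if_distrib[of "\<lambda>c. c * _"] sum.If_cases
        Int_absorb1)
  finally show ?thesis .
qed

lemma v_cell_nonneg: "I \<in> P \<Longrightarrow> 0 \<le> (LINT x:I|M. v x)"
  using cells_subset v_pos unfolding set_lebesgue_integral_def
  by (intro Bochner_Integration.integral_nonneg) (auto split: split_indicator intro: less_imp_le)

lemma cell_null_if_v_zero:
  assumes I: "I \<in> P" and "(LINT x:I|M. v x) = 0"
  shows "AE x in M. x \<notin> I"
proof -
  have "AE x in M. indicator I x *\<^sub>R v x = 0"
    using assms integrable_cell[OF integrable_v I] v_pos cells_subset[OF I]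
    unfolding set_integrable_def set_lebesgue_integral_def
    by (subst integral_nonneg_eq_0_iff_AE[symmetric])
      (auto split: split_indicator intro!: AE_I2 less_imp_le)
  then show ?thesis
    by (rule AE_mp, intro AE_I2) (use v_pos in \<open>force split: split_indicator\<close>)
qed

text \<open>Such a cell is a null set because \<open>v\<close> is positive, so the integral vanishes
  for every \<open>u\<close>, integrable or not. This makes the division in \<open>coeff\<close>
  harmless.\<close>

lemma u_cell_zero_if_v_zero:
  assumes "I \<in> P" "(LINT x:I|M. v x) = 0"
  shows "(LINT x:I|M. u x) = (0::real)"
proof -
  have "AE x in M. indicator I x *\<^sub>R u x = 0"
    using cell_null_if_v_zero[OF assms] by (auto elim!: AE_mp)
  then show ?thesis unfolding set_lebesgue_integral_def by (rule integral_eq_zero_AE)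
qed

lemma v_cell_pos:
  fixes u :: "'a \<Rightarrow> real"
  assumes "I \<in> P" "0 < (LINT x:I|M. u x)"
  shows "0 < (LINT x:I|M. v x)"
  using v_cell_nonneg[OF assms(1)] u_cell_zero_if_v_zero[OF assms(1), of u] assms(2)
  by (cases "(LINT x:I|M. v x) = 0") auto

lemma coeff_mult: "I \<in> P \<Longrightarrow> coeff u I * (LINT x:I|M. v x) = (LINT x:I|M. u x)"
  using u_cell_zero_if_v_zero[of I u] by (auto simp: coeff_def)

lemma reweight_eq: "I \<in> P \<Longrightarrow> x \<in> I \<Longrightarrow> reweight u x = coeff u I * v x"
  by (simp add: reweight_def step_eq)

lemma integrable_reweight: "integrable M (reweight u)"
  using integrable_step_mult[OF integrable_v] by (simp add: reweight_def[abs_def])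

lemma integral_reweight_cell:
  assumes I: "I \<in> P"
  shows "(LINT x:I|M. reweight u x) = (LINT x:I|M. u x)"
proof -
  have "(LINT x:I|M. reweight u x) = (LINT x:I|M. coeff u I * v x)"
    unfolding set_lebesgue_integral_def
    by (intro Bochner_Integration.integral_cong)
      (auto simp: reweight_eq[OF I] split: split_indicator)
  also have "\<dots> = coeff u I * (LINT x:I|M. v x)" by simp
  finally show ?thesis using coeff_mult[OF I] by simp
qed

lemma integral_reweight_cells:
  assumes "integrable M u" "Q \<subseteq> P"
  shows "(LINT x:\<Union>Q|M. reweight u x) = (LINT x:\<Union>Q|M. u x)"
  unfolding integral_cells[OF assms] integral_cells[OF integrable_reweight assms(2)]
  using assms(2) by (intro sum.cong) (auto simp: integral_reweight_cell)

lemma integral_cells_all: "(LINT x:\<Union>P|M. u x) = (LINT x|M. u x :: real)"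
  by (simp add: Union_cells set_lebesgue_integral_def cong: Bochner_Integration.integral_cong)

lemma cell_nonneg:
  assumes "\<forall>x\<in>space M. 0 \<le> u x" "I \<in> P"
  shows "0 \<le> (LINT x:I|M. u x :: real)"
  using assms cells_subset[OF assms(2)] unfolding set_lebesgue_integral_def
  by (intro Bochner_Integration.integral_nonneg) (auto split: split_indicator)

lemma coeff_nonneg:
  assumes "\<forall>x\<in>space M. 0 \<le> u x" "I \<in> P"
  shows "0 \<le> coeff u I"
  using cell_nonneg[OF assms] v_cell_nonneg[OF assms(2)] by (simp add: coeff_def)

lemma reweight_nonneg:
  assumes "\<forall>x\<in>space M. 0 \<le> u x" "x \<in> space M"
  shows "0 \<le> reweight u x"
proof -
  obtain I where "I \<in> P" "x \<in> I" using cell_exists assms(2) .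
  with coeff_nonneg[OF assms(1)] assms(2) v_pos[of x] show ?thesis by (simp add: reweight_eq)
qed

text \<open>Nonnegativity and zero mass force \<open>u\<close> to vanish almost everywhere on such a
  cell. Gibbs' inequality against \<open>reweight u\<close> needs a positive second argument, so
  these cells are settled separately.\<close>

lemma zero_on_zero_coeff:
  assumes u: "integrable M u" "\<forall>x\<in>space M. 0 \<le> u x"
  shows "AE x in M. step (coeff u) x = 0 \<longrightarrow> u x = 0"
proof -
  have "AE x in M. x \<in> I \<longrightarrow> u x = 0" if I: "I \<in> P" "coeff u I = 0" for I
  proof -
    have "(LINT x:I|M. u x) = 0" using coeff_mult[OF I(1), of u] I by simp
    then have "AE x in M. indicator I x *\<^sub>R u x = 0"
      using integrable_cell[OF u(1) I(1)] u(2) cells_subset[OF I(1)]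
      unfolding set_integrable_def set_lebesgue_integral_def
      by (subst integral_nonneg_eq_0_iff_AE[symmetric])
        (auto split: split_indicator intro!: AE_I2)
    then show ?thesis by (auto elim!: AE_mp)
  qed
  then have "AE x in M. \<forall>I\<in>P. coeff u I = 0 \<longrightarrow> x \<in> I \<longrightarrow> u x = 0"
    using finite_cells by (intro AE_finite_allI) (auto intro: AE_I2)
  then show ?thesis
  proof (rule AE_mp, intro AE_I2 impI)
    fix x
    assume "x \<in> space M" and 0: "step (coeff u) x = 0"
      and ae: "\<forall>I\<in>P. coeff u I = 0 \<longrightarrow> x \<in> I \<longrightarrow> u x = 0"
    then obtain I where "I \<in> P" "x \<in> I" using cell_exists by blast
    with 0 ae show "u x = 0" by (simp add: step_eq)
  qed
qed

text \<open>On each cell \<open>reweight u / v\<close> is constant, so the integrand is a step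
  function times an integrable function. In particular the cross entropy of a reweighted density is
  finite and depends on \<open>u\<close> only through its cell masses.\<close>

lemma reweight_entropy:
  assumes "\<forall>x\<in>space M. 0 \<le> u x"
  shows "has_bochner_integral M (\<lambda>x. reweight u x * ln (reweight u x / v x))
    (\<Sum>I\<in>P. (LINT x:I|M. v x) * (coeff u I * ln (coeff u I)))"
proof -
  have "has_bochner_integral M (\<lambda>x. step (\<lambda>I. ln (coeff u I)) x * reweight u x)
      (\<Sum>I\<in>P. ln (coeff u I) * (LINT x:I|M. reweight u x))"
    by (rule has_integral_step_mult[OF integrable_reweight])
  also have "(\<Sum>I\<in>P. ln (coeff u I) * (LINT x:I|M. reweight u x)) =
      (\<Sum>I\<in>P. (LINT x:I|M. v x) * (coeff u I * ln (coeff u I)))"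
    by (intro sum.cong) (simp_all add: integral_reweight_cell coeff_mult[of _ u, symmetric])
  finally show ?thesis
  proof (rule has_bochner_integral_cong[THEN iffD1, rotated -1])
    fix x assume x: "x \<in> space M"
    then obtain I where "I \<in> P" "x \<in> I" by (rule cell_exists)
    with v_pos[OF x] show "step (\<lambda>I. ln (coeff u I)) x * reweight u x
        = reweight u x * ln (reweight u x / v x)"
      by (simp add: step_eq reweight_eq)
  qed simp_all
qed

text \<open>Where the reweighted density \<open>g\<close> is \<open>c\<close> times \<open>v\<close>, the integrand \<open>u ln (u / v)\<close> is
  \<open>u ln (u / g) + u ln c \<ge> u - g + u ln c\<close>; the last expression has the same integral as
  \<open>g ln (g / v)\<close>, because \<open>u\<close> and \<open>g\<close> have equal integrals over the cells.\<close>

lemma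
  assumes u: "integrable M u" "\<forall>x\<in>space M. 0 \<le> u x"
    and ent: "integrable M (\<lambda>x. u x * ln (u x / v x))"
  shows reweight_entropy_le:
      "(LINT x|M. reweight u x * ln (reweight u x / v x)) \<le> (LINT x|M. u x * ln (u x / v x))"
    and reweight_unique:
      "(LINT x|M. u x * ln (u x / v x)) \<le> (LINT x|M. reweight u x * ln (reweight u x / v x))
        \<Longrightarrow> AE x in M. u x = reweight u x"
proof -
  define G where "G x = u x - reweight u x + step (\<lambda>I. ln (coeff u I)) x * u x" for x
  have intG: "integrable M G"
    unfolding G_def using u(1) by (intro Bochner_Integration.integrable_add
        Bochner_Integration.integrable_diff integrable_reweight integrable_step_mult)
  have "integral\<^sup>L M G = (LINT x|M. u x) - (LINT x|M. reweight u x)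
      + (\<Sum>I\<in>P. ln (coeff u I) * (LINT x:I|M. u x))"
    unfolding G_def using u(1)
    by (simp add: integrable_reweight integrable_step_mult integral_step_mult)
  also have "(LINT x|M. reweight u x) = (LINT x|M. u x)"
    using integral_reweight_cells[OF u(1) subset_refl] by (simp add: integral_cells_all)
  also have "(\<Sum>I\<in>P. ln (coeff u I) * (LINT x:I|M. u x))
      = (LINT x|M. reweight u x * ln (reweight u x / v x))"
    using has_bochner_integral_integral_eq[OF reweight_entropy[OF u(2)]]
    by (auto simp: coeff_mult[of _ u, symmetric] intro!: sum.cong)
  finally have G: "integral\<^sup>L M G = (LINT x|M. reweight u x * ln (reweight u x / v x))"
    by simp
  have pointwise: "AE x in M. G x \<le> u x * ln (u x / v x) \<and>
      (G x = u x * ln (u x / v x) \<longrightarrow> u x = reweight u x)"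
    using zero_on_zero_coeff[OF u]
  proof (rule AE_mp, intro AE_I2 impI)
    fix x assume x: "x \<in> space M" and 0: "step (coeff u) x = 0 \<longrightarrow> u x = 0"
    obtain I where I: "I \<in> P" "x \<in> I" using cell_exists x .
    note [simp] = step_eq[OF I] reweight_eq[OF I] G_def
    show "G x \<le> u x * ln (u x / v x) \<and> (G x = u x * ln (u x / v x) \<longrightarrow> u x = reweight u x)"
    \<comment> \<open>With coefficient 0 also \<open>u x = 0\<close>, and \<open>G x\<close>, the
      integrand and \<open>reweight u x\<close> are all 0.\<close>
    proof (cases "coeff u I = 0")
      case True
      with 0 show ?thesis by simp
    next
      case False
      then have c: "0 < coeff u I" using coeff_nonneg[OF u(2) I(1)] by simp
      then have g: "0 < reweight u x" using v_pos[OF x] by simp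
      have "u x * ln (u x / v x) = u x * ln (u x / reweight u x) + ln (coeff u I) * u x"
        using c v_pos[OF x] bspec[OF u(2) x] by (cases "u x = 0") (auto simp: ln_div ln_mult_pos algebra_simps)
      with mult_ln_div_ge[OF bspec[OF u(2) x] g] mult_ln_div_eq_imp[OF bspec[OF u(2) x] g]
      show ?thesis by simp
    qed
  qed
  show "(LINT x|M. reweight u x * ln (reweight u x / v x)) \<le> (LINT x|M. u x * ln (u x / v x))"
    unfolding G[symmetric] using pointwise by (intro integral_mono_AE intG ent) auto
  show "AE x in M. u x = reweight u x"
    if le: "(LINT x|M. u x * ln (u x / v x)) \<le> (LINT x|M. reweight u x * ln (reweight u x / v x))"
  proof -
    \<comment> \<open>The difference is nonnegative almost everywhere by \<open>pointwise\<close>,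
      and \<open>le\<close> makes its integral nonpositive; so it vanishes almost everywhere and the
      equality case of Gibbs' inequality applies.\<close>
    have "(LINT x|M. u x * ln (u x / v x) - G x) = 0"
    proof (rule antisym)
      show "0 \<le> (LINT x|M. u x * ln (u x / v x) - G x)"
        using pointwise by (intro integral_nonneg_AE) auto
    qed (use le G ent intG in simp)
    then have "AE x in M. u x * ln (u x / v x) - G x = 0"
      using pointwise ent intG by (subst integral_nonneg_eq_0_iff_AE[symmetric]) auto
    with pointwise show ?thesis by eventually_elim auto
  qed
qed

lemma coeff_mix:
  assumes "integrable M u" "integrable M w" "I \<in> P"
  shows "coeff (\<lambda>x. (1 - t) * u x + t * w x) I = (1 - t) * coeff u I + t * coeff w I"
  using integrable_cell[OF assms(1,3)] integrable_cell[OF assms(2,3)]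
  by (simp add: coeff_def add_divide_distrib)

end

section \<open>Half-open intervals\<close>

text \<open>Feasibility and objective are stated on the closed interval, while \<open>v\<close> is
  controlled only away from 0; the difference is a null point.\<close>

lemma set_integrable_atLeastAtMost_iff:
  "set_integrable lborel {0..b::real} f \<longleftrightarrow> set_integrable lborel {0<..b} f"
  for f :: "real \<Rightarrow> real"
  by (rule set_integrable_discrete_difference[where X="{0}"]) auto

lemma set_integral_atLeastAtMost_eq: "(LBINT x:{0..b::real}. f x) = (LBINT x:{0<..b}. f x)"
  for f :: "real \<Rightarrow> real"
  by (rule set_integral_discrete_difference[where X="{0}"]) auto

text \<open>\<open>v\<close> may be unbounded near 0, so its continuity on the half-open interval is
  not enough. Since \<open>V\<close> is continuous up to 0, the improper integral is the finite
  number \<open>V b - V 0\<close>, and for a nonnegative integrand this gives integrability.\<close>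

lemma integrable_nonneg_derivative:
  fixes V v :: "real \<Rightarrow> real"
  assumes "0 < b" and V: "continuous_on {0..b} V"
    and V': "\<And>x. x \<in> {0<..b} \<Longrightarrow> (V has_real_derivative v x) (at x within {0<..b})"
    and v: "continuous_on {0<..b} v" "\<And>x. x \<in> {0<..b} \<Longrightarrow> 0 \<le> v x"
  shows "set_integrable lborel {0<..b} v"
proof -
  have at: "at x within {0<..b} = at x" if "0 < x" "x < b" for x :: real
    by (rule at_within_open_subset[of _ "{0<..<b}"]) (use that in auto)
  have "set_integrable lborel (einterval (ereal 0) (ereal b)) v"
  proof (rule interval_integral_FTC_nonneg(1)[where F=V and A="V 0" and B="V b"])
    show "DERIV V x :> v x" if "ereal 0 < ereal x" "ereal x < ereal b" for x
      using V'[of x] at[of x] that by simp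
    show "isCont v x" if "ereal 0 < ereal x" "ereal x < ereal b" for x
      using v(1)[unfolded continuous_on_eq_continuous_within, rule_format, of x] at[of x] that
      by simp
    show "((V \<circ> real_of_ereal) \<longlongrightarrow> V 0) (at_right (ereal 0))"
      using continuous_on_Icc_at_rightD[OF V \<open>0 < b\<close>] by (simp only: ereal_tendsto_simps)
    show "((V \<circ> real_of_ereal) \<longlongrightarrow> V b) (at_left (ereal b))"
      using continuous_on_Icc_at_leftD[OF V \<open>0 < b\<close>] by (simp only: ereal_tendsto_simps)
  qed (use v(2) \<open>0 < b\<close> in auto)
  then have "set_integrable lborel {0<..<b} v" by simp
  also have "set_integrable lborel {0<..<b} v \<longleftrightarrow> set_integrable lborel {0<..b} v"
    by (rule set_integrable_discrete_difference[where X="{b}"]) auto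
  finally show ?thesis .
qed

lemma UN_greaterThanAtMost_mono:
  fixes s :: "nat \<Rightarrow> 'a :: linorder"
  assumes "mono s"
  shows "(\<Union>e<k. {s e<..s (Suc e)}) = {s 0<..s k}"
proof (induction k)
  case (Suc k)
  with monoD[OF assms, of 0 k] monoD[OF assms, of k "Suc k"] show ?case
    by (auto simp: lessThan_Suc)
qed simp

lemma disjoint_greaterThanAtMost_mono:
  fixes s :: "nat \<Rightarrow> 'a :: linorder"
  assumes "mono s"
  shows "disjoint ((\<lambda>e. {s e<..s (Suc e)}) ` A)"
proof -
  have "{s e<..s (Suc e)} \<inter> {s e'<..s (Suc e')} = {}" if "e < e'" for e e'
    using monoD[OF assms, of "Suc e" e'] that by force
  then show ?thesis
    unfolding disjoint_def by (metis (no_types, lifting) Int_commute imageE linorder_neqE_nat)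
qed

lemma AE_eq_imp_eq_on_greaterThanAtMost:
  fixes f g :: "real \<Rightarrow> real"
  assumes ae: "AE x\<in>{a<..b} in lborel. f x = g x"
    and cont: "continuous_on {a<..b} f" "continuous_on {a<..b} g" and y: "y \<in> {a<..b}"
  shows "f y = g y"
proof (rule ccontr)
  assume "f y \<noteq> g y"
  then have "0 < \<bar>f y - g y\<bar>" by simp
  moreover have "continuous_on {a<..b} (\<lambda>x. f x - g x)" by (intro continuous_intros cont)
  ultimately obtain d where d: "0 < d"
    "\<And>x. x \<in> {a<..b} \<Longrightarrow> dist x y < d \<Longrightarrow> dist (f x - g x) (f y - g y) < \<bar>f y - g y\<bar>"
    using y unfolding continuous_on_iff by blast
  \<comment> \<open>A neighbourhood to the left of \<open>y\<close> stays inside the interval even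
    when \<open>y = b\<close>, and it has positive measure.\<close>
  define l where "l = max a (y - d)"
  have l: "l < y" using d y by (auto simp: l_def)
  have "AE x in lborel. x \<notin> {l<..<y}"
    using ae
  proof (rule AE_mp, intro AE_I2 impI notI)
    fix x assume "x \<in> {a<..b} \<longrightarrow> f x = g x" "x \<in> {l<..<y}"
    with d(2)[of x] y show False by (auto simp: l_def dist_real_def)
  qed
  then have "{l<..<y} \<in> null_sets lborel" by (simp add: AE_iff_null_sets)
  then show False using l by (simp add: null_sets_def)
qed

section \<open>The preference context\<close>

lemma satisfies_cong:
  assumes "\<And>\<rho>. \<rho> \<in> constraint_rankings c \<Longrightarrow> (LBINT x:{0..real \<rho>}. u x) = (LBINT x:{0..real \<rho>}. w x)"
  shows "satisfies u c \<longleftrightarrow> satisfies w c"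
  using assms by (cases c) simp_all

text \<open>Each constraint is an affine equation in the integrals up to its rankings, and the
  weights \<open>1 - t\<close> and \<open>t\<close> sum to 1.\<close>

lemma satisfies_convex:
  assumes "satisfies u c" "satisfies w c"
    and "\<And>\<rho>. \<rho> \<in> constraint_rankings c \<Longrightarrow> (LBINT x:{0..real \<rho>}. h x) =
      (1 - t) * (LBINT x:{0..real \<rho>}. u x) + t * (LBINT x:{0..real \<rho>}. w x)"
  shows "satisfies h c"
proof (cases c)
  case (Ratio_Scale \<rho> \<alpha>)
  then have "(LBINT x:{0..real \<rho>}. u x) = \<alpha> * (LBINT x:{0..real (\<rho> - 1)}. u x)"
    "(LBINT x:{0..real \<rho>}. w x) = \<alpha> * (LBINT x:{0..real (\<rho> - 1)}. w x)"
    using assms(1,2) by simp_all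
  then have "(LBINT x:{0..real \<rho>}. h x) = \<alpha> * (LBINT x:{0..real (\<rho> - 1)}. h x)"
    using Ratio_Scale by (simp only: assms(3) constraint_rankings.simps insert_iff simp_thms)
      (simp add: algebra_simps)
  with Ratio_Scale show ?thesis by simp
next
  case (Absolute_Difference \<rho> \<beta>)
  then have "(LBINT x:{0..real \<rho>}. u x) = \<beta> + (LBINT x:{0..real (\<rho> - 1)}. u x)"
    "(LBINT x:{0..real \<rho>}. w x) = \<beta> + (LBINT x:{0..real (\<rho> - 1)}. w x)"
    using assms(1,2) by simp_all
  with Absolute_Difference assms(3)[of \<rho>] assms(3)[of "\<rho> - 1"] show ?thesis
    by (simp add: algebra_simps)
next
  case (Lower_Bound \<rho> \<gamma>)
  with assms show ?thesis by (simp add: algebra_simps)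
qed

lemma constraint_rankings_le: "\<rho> \<in> constraint_rankings c \<Longrightarrow> \<rho> \<le> constraint_rank c"
  by (cases c) auto

lemma preference_context_convex:
  assumes u: "u \<in> preference_context K C" and w: "w \<in> preference_context K C"
    and t: "0 \<le> t" "t \<le> 1" and ranks: "\<And>c. c \<in> C \<Longrightarrow> constraint_rank c \<le> K"
  shows "(\<lambda>x. (1 - t) * u x + t * w x) \<in> preference_context K C"
proof -
  \<comment> \<open>Linearity of the Bochner integral needs integrability up to each ranking, which
    holds because the rankings are at most \<open>K\<close>.\<close>
  have int: "set_integrable lborel {0..real \<rho>} f" if "f \<in> preference_context K C" "\<rho> \<le> K" for f \<rho>
    by (rule set_integrable_subset[of lborel "{0..real K}"])
      (use that in \<open>auto simp: preference_context_def utility_densities_def\<close>)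
  have mix: "(LBINT x:{0..real \<rho>}. (1 - t) * u x + t * w x) =
      (1 - t) * (LBINT x:{0..real \<rho>}. u x) + t * (LBINT x:{0..real \<rho>}. w x)" if "\<rho> \<le> K" for \<rho>
    using int[OF u that] int[OF w that] by simp
  have "(\<lambda>x. (1 - t) * u x + t * w x) \<in> utility_densities K"
    using u w t int[OF u order_refl] int[OF w order_refl] mix[OF order_refl]
    by (auto simp: preference_context_def utility_densities_def)
  moreover have "satisfies (\<lambda>x. (1 - t) * u x + t * w x) c" if "c \<in> C" for c
  proof (rule satisfies_convex)
    show "satisfies u c" "satisfies w c" using u w that by (auto simp: preference_context_def)
    show "(LBINT x:{0..real \<rho>}. (1 - t) * u x + t * w x) =
      (1 - t) * (LBINT x:{0..real \<rho>}. u x) + t * (LBINT x:{0..real \<rho>}. w x)"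
      if "\<rho> \<in> constraint_rankings c" for \<rho>
      using mix constraint_rankings_le[OF that] ranks[OF \<open>c \<in> C\<close>] by simp
  qed
  ultimately show ?thesis by (simp add: preference_context_def)
qed

text \<open>The common risk preference is \<open>- (D x / v x)\<close> with \<open>D\<close> the
  derivative of \<open>v\<close>; the factor \<open>c\<close> only adds the constant
  \<open>ln c\<close> to the logarithm.\<close>

lemma same_risk_preference_mult:
  assumes "0 < c" and I: "I \<subseteq> {0<..real K}" and w: "\<And>x. x \<in> I \<Longrightarrow> w x = c * v x"
    and v: "\<And>x. x \<in> {0<..real K} \<Longrightarrow> v differentiable (at x within {0<..real K})"
      "\<And>x. x \<in> {0<..real K} \<Longrightarrow> 0 < v x"
  shows "same_risk_preference K v w I"
proof -
  have "\<exists>D. (v has_real_derivative D) (at x within {0<..real K})" if "x \<in> {0<..real K}" for x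
    using v(1)[OF that] by (simp add: real_differentiable_def)
  then obtain D where D: "\<And>x. x \<in> {0<..real K} \<Longrightarrow>
      (v has_real_derivative D x) (at x within {0<..real K})" by metis
  have lnv: "((\<lambda>x. ln (v x)) has_real_derivative D x / v x) (at x within {0<..real K})"
    if "x \<in> {0<..real K}" for x
    using D[OF that] v(2)[OF that] by (auto intro!: derivative_eq_intros)
  have lnw: "((\<lambda>x. ln (w x)) has_real_derivative D x / v x) (at x within I)" if x: "x \<in> I" for x
  proof -
    have "((\<lambda>x. ln c + ln (v x)) has_real_derivative D x / v x) (at x within I)"
      using DERIV_add[OF DERIV_const DERIV_subset[OF lnv I]] x I by auto
    then show ?thesis
    proof (rule has_field_derivative_transform_within[OF _ zero_less_one x])
      fix y assume "y \<in> I"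
      with w I v(2)[of y] \<open>0 < c\<close> show "ln c + ln (v y) = ln (w y)"
        by (auto simp: ln_mult_pos)
    qed
  qed
  show ?thesis
    unfolding same_risk_preference_def has_risk_preference_def
    by (rule exI[of _ "\<lambda>x. - (D x / v x)"]) (use lnv lnw v(2) I w \<open>0 < c\<close> in auto)
qed

section \<open>The optimisation problem and its cells\<close>

locale preference_problem =
  fixes K E :: nat
    and C :: "preference_constraint set"
    and r :: "nat \<Rightarrow> nat"
    and V v :: "real \<Rightarrow> real"
  assumes ranks: "\<And>c. c \<in> C \<Longrightarrow> constraint_rank c \<in> {1..K}"
    and E: "1 \<le> E"
    and r_mono: "strict_mono_on {1..E} r"
    and r_image: "r ` {1..E} = (\<Union>c\<in>C. constraint_rankings c)"
    and V_cont: "continuous_on {0..real K} V"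
    and V_deriv: "\<And>x. x \<in> {0<..real K} \<Longrightarrow> (V has_real_derivative v x) (at x within {0<..real K})"
    and v_diff: "\<And>x. x \<in> {0<..real K} \<Longrightarrow> v differentiable (at x within {0<..real K})"
    and v_positive: "\<And>x. x \<in> {0<..real K} \<Longrightarrow> 0 < v x"
begin

abbreviation cells :: "real set set" where
  "cells \<equiv> preference_intervals K E r"

abbreviation M :: "real measure" where
  "M \<equiv> restrict_space lborel {0<..real K}"

text \<open>Padding the rankings with 0 in front and \<open>K\<close> behind makes the first, middle
  and last intervals instances of one formula. The outer two may be empty, since
  \<open>r 1 = 0\<close> and \<open>r E = K\<close> are possible.\<close>

definition breakpoint :: "nat \<Rightarrow> real" where
  "breakpoint e = (if e = 0 then 0 else if e \<le> E then real (r e) else real K)"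

lemma r_le: "e \<in> {1..E} \<Longrightarrow> r e \<le> K"
  using r_image ranks constraint_rankings_le
  by (metis UN_E atLeastAtMost_iff imageI order_trans)

lemma K_pos: "0 < K"
proof -
  have "r 1 \<in> (\<Union>c\<in>C. constraint_rankings c)" using r_image E by auto
  then show ?thesis using ranks by fastforce
qed

lemma mono_breakpoint: "mono breakpoint"
  using r_le strict_mono_on_leD[OF r_mono] by (auto simp: mono_def breakpoint_def)

lemma cells_eq: "cells = (\<lambda>e. {breakpoint e<..breakpoint (Suc e)}) ` {..<Suc E}"
proof -
  \<comment> \<open>Index shift: the middle interval ending at \<open>r e\<close> has index
    \<open>e - 1\<close>; index 0 is the first interval and index \<open>E\<close> the last.\<close>
  have "{..<Suc E} = {0} \<union> (\<lambda>e. e - 1) ` ({1..E} - {1}) \<union> {E}"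
  proof -
    have "e \<in> (\<lambda>e. e - 1) ` ({1..E} - {1})" if "e \<noteq> 0" "e < E" for e
      using that by (intro image_eqI[of _ _ "Suc e"]) auto
    then show ?thesis by (fastforce simp: less_Suc_eq)
  qed
  moreover have "(\<lambda>e. {breakpoint (e - 1)<..breakpoint (Suc (e - 1))}) ` ({1..E} - {1})
      = (\<lambda>e. {real (r (e - 1))<..real (r e)}) ` ({1..E} - {1})"
    by (intro image_cong) (auto simp: breakpoint_def)
  ultimately show ?thesis
    using E by (simp only: image_Un image_image)
      (simp add: preference_intervals_def breakpoint_def)
qed

text \<open>Every upper integration limit in a constraint, including the predecessor of its rank, is
  some breakpoint \<open>r e\<close>, so the interval up to it consists of the first
  \<open>e\<close> cells.\<close>

lemma rank_cells:
  assumes "c \<in> C" "\<rho> \<in> constraint_rankings c"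
  obtains Q where "Q \<subseteq> cells" "\<Union>Q = {0<..real \<rho>}"
proof -
  obtain e where e: "e \<in> {1..E}" "\<rho> = r e" using assms r_image by blast
  show ?thesis
  proof
    show "(\<lambda>e. {breakpoint e<..breakpoint (Suc e)}) ` {..<e} \<subseteq> cells"
      unfolding cells_eq using e by (intro image_mono) auto
    show "\<Union>((\<lambda>e. {breakpoint e<..breakpoint (Suc e)}) ` {..<e}) = {0<..real \<rho>}"
      using UN_greaterThanAtMost_mono[OF mono_breakpoint, of e] e by (simp add: breakpoint_def)
  qed
qed

lemma Union_preference_intervals: "\<Union>cells = {0<..real K}"
  unfolding cells_eq using UN_greaterThanAtMost_mono[OF mono_breakpoint, of "Suc E"]
  by (simp add: breakpoint_def)

section \<open>Translation between \<open>M\<close> and Lebesgue measure on the closed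
  interval\<close>

lemma integrable_M: "integrable M f \<longleftrightarrow> set_integrable lborel {0..real K} f" for f :: "real \<Rightarrow> real"
  unfolding set_integrable_atLeastAtMost_iff
  by (simp add: set_integrable_def integrable_restrict_space)

lemma integral_M: "(LINT x|M. f x) = (LBINT x:{0..real K}. f x)" for f :: "real \<Rightarrow> real"
  unfolding set_integral_atLeastAtMost_eq
  by (simp add: set_lebesgue_integral_def integral_restrict_space)

lemma set_integral_M:
  fixes f :: "real \<Rightarrow> real"
  assumes "B \<subseteq> {0<..real K}"
  shows "(LINT x:B|M. f x) = (LBINT x:B. f x)"
  unfolding set_lebesgue_integral_def
  by (subst integral_restrict_space)
    (use assms in \<open>auto intro!: Bochner_Integration.integral_cong split: split_indicator\<close>)

lemma AE_M: "(AE x in M. Q x) \<longleftrightarrow> (AE x\<in>{0..real K} in lborel. Q x)"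
proof -
  have "(AE x in M. Q x) \<longleftrightarrow> (AE x\<in>{0<..real K} in lborel. Q x)"
    by (rule AE_restrict_space_iff) simp
  also have "\<dots> \<longleftrightarrow> (AE x\<in>{0..real K} in lborel. Q x)"
    using AE_lborel_singleton[of "0::real"]
    by (intro eventually_subst) (auto elim!: eventually_mono)
  finally show ?thesis .
qed

lemma v_cont: "continuous_on {0<..real K} v"
  using v_diff by (intro differentiable_imp_continuous_on) (auto simp: differentiable_on_def)

sublocale cell_partition M cells v
proof
  show "finite cells" "disjoint cells"
    unfolding cells_eq by (auto intro: disjoint_greaterThanAtMost_mono mono_breakpoint)
  show "\<Union>cells = space M" by (simp add: Union_preference_intervals space_restrict_space)
  show "cells \<subseteq> sets M"
  proof
    fix I assume "I \<in> cells"
    then have "I \<subseteq> {0<..real K}" "I \<in> sets borel"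
      using Union_preference_intervals by (blast, auto simp: cells_eq)
    then show "I \<in> sets M" by (simp add: sets_restrict_space_iff)
  qed
  have "set_integrable lborel {0<..real K} v"
    using K_pos V_cont V_deriv v_positive v_cont
    by (intro integrable_nonneg_derivative) (auto intro: less_imp_le)
  then show "integrable M v" by (simp add: integrable_M set_integrable_atLeastAtMost_iff)
qed (auto simp: space_restrict_space v_positive)

lemma context_integrable: "u \<in> preference_context K C \<Longrightarrow> integrable M u"
  by (simp add: integrable_M preference_context_def utility_densities_def)

lemma context_nonneg: "u \<in> preference_context K C \<Longrightarrow> \<forall>x\<in>space M. 0 \<le> u x"
  by (auto simp: space_restrict_space preference_context_def utility_densities_def)

lemma reweight_in_context:
  assumes u: "u \<in> preference_context K C"
  shows "reweight u \<in> preference_context K C"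
proof -
  have prefix: "(LBINT x:{0..real \<rho>}. reweight u x) = (LBINT x:{0..real \<rho>}. u x)"
    if "Q \<subseteq> cells" "\<Union>Q = {0<..real \<rho>}" for \<rho> Q
  proof -
    have "{0<..real \<rho>} \<subseteq> {0<..real K}" using that Union_preference_intervals by blast
    then show ?thesis
      using integral_reweight_cells[OF context_integrable[OF u] that(1)]
      unfolding that(2) set_integral_atLeastAtMost_eq by (simp add: set_integral_M)
  qed
  have "0 \<le> reweight u x" if "x \<in> {0..real K}" for x
  proof (cases "x = 0")
    case True
    \<comment> \<open>The point 0 lies in no cell, so \<open>reweight u\<close> is 0 there;
      feasibility asks for nonnegativity at 0 too.\<close>
    then have "x \<notin> I" if "I \<in> cells" for I using that Union_preference_intervals by fastforce
    then show ?thesis by (simp add: reweight_def step_def)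
  next
    case False
    with that show ?thesis
      by (intro reweight_nonneg context_nonneg[OF u]) (auto simp: space_restrict_space)
  qed
  moreover have "set_integrable lborel {0..real K} (reweight u)"
    using integrable_reweight[of u] by (simp add: integrable_M)
  moreover have "(LBINT x:{0..real K}. reweight u x) = 1"
    using prefix[OF subset_refl Union_preference_intervals] u
    by (simp add: preference_context_def utility_densities_def)
  moreover have "satisfies (reweight u) c" if "c \<in> C" for c
  proof -
    have "satisfies (reweight u) c \<longleftrightarrow> satisfies u c"
      using rank_cells[OF that] prefix by (intro satisfies_cong) metis
    with u that show ?thesis by (simp add: preference_context_def)
  qed
  ultimately show ?thesis by (simp add: preference_context_def utility_densities_def)
qed

section \<open>Cross entropy and optimal densities\<close>

lemma cross_entropy_M:
  "cross_entropy K v u = (if integrable M (\<lambda>x. u x * ln (u x / v x))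
    then ereal (LINT x|M. u x * ln (u x / v x)) else \<infinity>)"
  unfolding cross_entropy_def integrable_M integral_M ..

lemma cross_entropy_reweight:
  assumes "u \<in> preference_context K C"
  shows "cross_entropy K v (reweight u) =
    ereal (\<Sum>I\<in>cells. (LINT x:I|M. v x) * (coeff u I * ln (coeff u I)))"
  using reweight_entropy[OF context_nonneg[OF assms]]
  by (simp add: cross_entropy_M has_bochner_integral_iff)

lemma cross_entropy_reweight_le:
  assumes "u \<in> preference_context K C"
  shows "cross_entropy K v (reweight u) \<le> cross_entropy K v u"
  using reweight_entropy_le[OF context_integrable context_nonneg, OF assms assms]
    reweight_entropy[OF context_nonneg[OF assms]]
  by (auto simp: cross_entropy_M has_bochner_integral_iff)

lemma optimal_reweight:
  assumes "optimal_density K C v p"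
  shows "optimal_density K C v (reweight p)"
  using assms reweight_in_context[of p] cross_entropy_reweight_le[of p]
  unfolding optimal_density_def by (meson order_trans)

lemma optimal_AE_eq_reweight:
  assumes "optimal_density K C v p"
  shows "AE x\<in>{0..real K} in lborel. p x = reweight p x"
proof -
  have p: "p \<in> preference_context K C"
    and le: "cross_entropy K v p \<le> cross_entropy K v (reweight p)"
    using assms reweight_in_context[of p] by (auto simp: optimal_density_def)
  have g: "integrable M (\<lambda>x. reweight p x * ln (reweight p x / v x))"
    using reweight_entropy[OF context_nonneg[OF p]] by (simp add: has_bochner_integral_iff)
  \<comment> \<open>The reweighted density has finite cross entropy, so by \<open>le\<close> that of
    \<open>p\<close> is not infinite.\<close>
  have ent: "integrable M (\<lambda>x. p x * ln (p x / v x))"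
    using le g by (auto simp: cross_entropy_M split: if_splits)
  have "AE x in M. p x = reweight p x"
    using le g ent
    by (intro reweight_unique context_integrable[OF p] context_nonneg[OF p])
      (auto simp: cross_entropy_M)
  then show ?thesis by (simp add: AE_M)
qed

text \<open>The mixture is reweighted before it is compared: the density \<open>q\<close> that
  witnesses nondegeneracy may have infinite cross entropy, whereas after reweighting the cross
  entropy is a finite sum in the coefficients.\<close>

lemma optimal_coeff_pos:
  assumes opt: "optimal_density K C v p" and I: "I \<in> cells" and nd: "nondegenerate K C I"
  shows "0 < coeff p I"
proof (rule ccontr)
  have p: "p \<in> preference_context K C" using opt by (simp add: optimal_density_def)
  obtain q where q: "q \<in> preference_context K C" and "0 < (LBINT x:I. q x)"
    using nd by (auto simp: nondegenerate_def)
  then have q_I: "0 < (LINT x:I|M. q x)"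
    using I Union_preference_intervals by (subst set_integral_M) auto
  note nonneg = coeff_nonneg[OF context_nonneg[OF p]] coeff_nonneg[OF context_nonneg[OF q]]
  assume "\<not> 0 < coeff p I"
  then have "coeff p I = 0" using nonneg(1)[OF I] by simp
  moreover have "0 < coeff q I" using q_I v_cell_pos[OF I q_I] by (simp add: coeff_def)
  ultimately obtain t where t: "0 < t" "t < 1" and less:
    "(\<Sum>J\<in>cells. (LINT x:J|M. v x) *
        (((1 - t) * coeff p J + t * coeff q J) * ln ((1 - t) * coeff p J + t * coeff q J)))
      < (\<Sum>J\<in>cells. (LINT x:J|M. v x) * (coeff p J * ln (coeff p J)))"
    using mult_ln_sum_decreases_off_zero[of cells I "\<lambda>J. LINT x:J|M. v x" "coeff p" "coeff q"]
      finite_cells I v_cell_nonneg nonneg v_cell_pos[OF I q_I] by blast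
  \<comment> \<open>By \<open>coeff_mix\<close> the left sum in \<open>less\<close> is exactly the
    cross entropy of \<open>reweight h\<close>.\<close>
  define h where "h x = (1 - t) * p x + t * q x" for x
  have h: "h \<in> preference_context K C"
    unfolding h_def[abs_def] using t ranks by (intro preference_context_convex p q) auto
  have "cross_entropy K v (reweight h) < cross_entropy K v (reweight p)"
    unfolding cross_entropy_reweight[OF h] cross_entropy_reweight[OF p] less_ereal.simps
    using less coeff_mix[OF context_integrable[OF p] context_integrable[OF q]]
    by (simp add: h_def[abs_def])
  also have "\<dots> \<le> cross_entropy K v (reweight h)"
    using optimal_reweight[OF opt] reweight_in_context[OF h] by (simp add: optimal_density_def)
  finally show False by simp
qed

end

theorem theorem4:
  fixes K E :: nat
    and C :: "preference_constraint set"
    and r :: "nat \<Rightarrow> nat"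
    and V v u_star :: "real \<Rightarrow> real"
  assumes "finite C"
    and "\<And>c. c \<in> C \<Longrightarrow> constraint_rank c \<in> {1..K}"
    and "1 \<le> E"
    and "strict_mono_on {1..E} r"
    and "r ` {1..E} = (\<Union>c\<in>C. constraint_rankings c)"
    and "continuous_on {0..real K} V"
    and "\<And>x. x \<in> {0<..real K} \<Longrightarrow> (V has_real_derivative v x) (at x within {0<..real K})"
    and "\<And>x. x \<in> {0<..real K} \<Longrightarrow> v differentiable (at x within {0<..real K})"
    and "\<And>x. x \<in> {0<..real K} \<Longrightarrow> 0 < v x"
    and "optimal_density K C v u_star"
  shows "(\<exists>w. (AE x\<in>{0..real K} in lborel. w x = u_star x) \<and>
              optimal_density K C v w \<and>
              (\<forall>I\<in>preference_intervals K E r. nondegenerate K C I \<longrightarrow>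
                 same_risk_preference K v w I)) \<and>
         (\<forall>I\<in>preference_intervals K E r. nondegenerate K C I \<and> continuous_on I u_star \<longrightarrow>
            same_risk_preference K v u_star I)"
proof -
  interpret preference_problem K E C r V v
    using assms by unfold_locales auto
  have eq: "AE x\<in>{0..real K} in lborel. u_star x = reweight u_star x"
    using assms(10) by (rule optimal_AE_eq_reweight)
  have risk: "same_risk_preference K v w I"
    if "I \<in> cells" "nondegenerate K C I" "\<And>x. x \<in> I \<Longrightarrow> w x = reweight u_star x" for w I
    using that Union_preference_intervals reweight_eq[OF that(1)] v_diff v_positive
    by (intro same_risk_preference_mult[OF optimal_coeff_pos[OF assms(10) that(1,2)]]) auto
  have "same_risk_preference K v u_star I"
    if I: "I \<in> cells" "nondegenerate K C I" "continuous_on I u_star" for I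
  proof (rule risk[OF I(1,2)])
    obtain a b where ab: "I = {a<..b}" using I(1) by (auto simp: cells_eq)
    have sub: "I \<subseteq> {0<..real K}" using I(1) Union_preference_intervals by blast
    have "continuous_on I v" using continuous_on_subset[OF v_cont sub] .
    then have "continuous_on I (\<lambda>x. coeff u_star I * v x)" by (intro continuous_intros)
    then have cont: "continuous_on I (reweight u_star)"
      by (rule continuous_on_eq) (simp add: reweight_eq[OF I(1)])
    have "AE x\<in>I in lborel. u_star x = reweight u_star x"
      using eq sub by (auto elim!: eventually_mono)
    \<comment> \<open>Both functions are continuous on the cell, so equality almost everywhere
      becomes equality at every point.\<close>
    then show "u_star x = reweight u_star x" if "x \<in> I" for x
      using AE_eq_imp_eq_on_greaterThanAtMost I(3) cont that unfolding ab by blast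
  qed
  moreover have "AE x\<in>{0..real K} in lborel. reweight u_star x = u_star x"
    using eq by (auto elim!: eventually_mono)
  \<comment> \<open>The witness \<open>w\<close> is \<open>reweight u_star\<close>: optimality is
    unaffected by changes on null sets, so \<open>u_star\<close> itself may be irregular on a
    cell.\<close>
  ultimately show ?thesis
    using optimal_reweight[OF assms(10)] risk by blast
qed

end
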